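(* Let $\mathcal{F}$ be a real separable Hilbert space, let $\Phi:\mathcal{F}\to(-\infty,\infty]$ be a generator with $\mathcal{A}=\operatorname{int}(\operatorname{dom}\Phi)$, and let $\mathcal{U}\subset\mathcal{A}$ be a nonempty convex set. Let $F$ be an $\mathcal{F}$-valued random element such that $\mathbb{P}(F\in\mathcal{U})=1$ and $\mathbb{E}\|F\|_{\mathcal{F}}<\infty$. Assume $\mathbb{E}|\Phi(F)|<\infty$ and that the Bochner mean $\bar f=\mathbb{E}[F]$ belongs to $\mathcal{U}$. Then for every $g\in\mathcal{U}$ for which $\mathbb{E}[d_\Phi(F,g)]$ is finite, $$\mathbb{E}\bigl[d_\Phi(F,g)\bigr]=\mathbb{E}\bigl[d_\Phi(F,\bar f)\bigr]+d_\Phi(\bar f,g).$$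
   Context: A function $\Phi:\mathcal{F}\to(-\infty,\infty]$ on a real Hilbert space $\mathcal{F}$ is called a generator if it is proper, lower semicontinuous, strictly convex, and Fréchet differentiable on $\mathcal{A}=\operatorname{int}(\operatorname{dom}\Phi)\neq\emptyset$. The Fréchet gradient $\nabla\Phi(g)\in\mathcal{F}$ is the Riesz representer of the Fréchet derivative. The functional Bregman divergence generated by $\Phi$ is, for $f,g\in\mathcal{A}$, $d_\Phi(f,g)=\Phi(f)-\Phi(g)-\langle\nabla\Phi(g),f-g\rangle_{\mathcal{F}}$. A random element of $\mathcal{F}$ is a measurable map from a probability space into $\mathcal{F}$ with its Borel $\sigma$-algebra; its Bochner mean is its Bochner integral with respect to $\mathbb{P}$. *)

theory Defs
  imports "HOL-Probability.Probability"
begin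

definition edom :: "('a \<Rightarrow> ereal) \<Rightarrow> 'a set" where
  "edom \<Phi> = {x. \<Phi> x < \<infinity>}"

(* The codomain (-\<infinity>, \<infinity>] of the mathematical text is rendered by ereal together with the
   first conjunct. *)
definition proper_fun :: "('a \<Rightarrow> ereal) \<Rightarrow> bool" where
  "proper_fun \<Phi> \<longleftrightarrow> (\<forall>x. \<Phi> x \<noteq> -\<infinity>) \<and> edom \<Phi> \<noteq> {}"

definition lower_semicontinuous :: "('a::topological_space \<Rightarrow> ereal) \<Rightarrow> bool" where
  "lower_semicontinuous \<Phi> \<longleftrightarrow> (\<forall>x. \<Phi> x \<le> Liminf (at x) \<Phi>)"

(* Strictness is only required for points of the effective domain, where both sides can be finite. *)
definition strictly_convex :: "('a::real_vector \<Rightarrow> ereal) \<Rightarrow> bool" where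
  "strictly_convex \<Phi> \<longleftrightarrow>
    (\<forall>x\<in>edom \<Phi>. \<forall>y\<in>edom \<Phi>. \<forall>t::real. x \<noteq> y \<and> 0 < t \<and> t < 1 \<longrightarrow>
       \<Phi> ((1 - t) *\<^sub>R x + t *\<^sub>R y) < ereal (1 - t) * \<Phi> x + ereal t * \<Phi> y)"

(* real_of_ereal sends \<infinity> to 0, but at a point of the interior of the effective domain
   differentiability only depends on the finite values of \<Phi> nearby. *)
definition generator :: "('a::real_inner \<Rightarrow> ereal) \<Rightarrow> bool" where
  "generator \<Phi> \<longleftrightarrow>
    proper_fun \<Phi> \<and> lower_semicontinuous \<Phi> \<and> strictly_convex \<Phi> \<and>
    interior (edom \<Phi>) \<noteq> {} \<and>
    (\<forall>x\<in>interior (edom \<Phi>). (\<lambda>y. real_of_ereal (\<Phi> y)) differentiable (at x))"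

(* GDERIV f g :> v says that h \<mapsto> h \<bullet> v is the Frechet derivative of f at g, i.e. that v is its
   Riesz representer. *)
definition frechet_gradient :: "('a::real_inner \<Rightarrow> ereal) \<Rightarrow> 'a \<Rightarrow> 'a" where
  "frechet_gradient \<Phi> g = (THE v. GDERIV (\<lambda>y. real_of_ereal (\<Phi> y)) g :> v)"

(* Meaningful for f and g in the interior of the effective domain. *)
definition bregman :: "('a::real_inner \<Rightarrow> ereal) \<Rightarrow> 'a \<Rightarrow> 'a \<Rightarrow> real" where
  "bregman \<Phi> f g =
    real_of_ereal (\<Phi> f) - real_of_ereal (\<Phi> g) - inner (frechet_gradient \<Phi> g) (f - g)"

end

theory Submission
  imports Defs
begin

text \<open>For each \<open>h\<close> the divergence of \<open>F\<close> from \<open>h\<close> differs from \<open>\<Phi> \<circ> F\<close> by an affine function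
  of \<open>F\<close>. The integral commutes with affine functions, and the expectation of the gradient
  term vanishes when \<open>h\<close> is the mean.\<close>

text \<open>Adding back the terms affine in \<open>F\<close>, integrable on a finite measure space,
  isolates \<open>\<Phi>\<close> along \<open>F\<close>; this yields its measurability too.\<close>

lemma integrable_Phi_if_integrable_bregman:
  fixes F :: "'w \<Rightarrow> 'a::{real_inner, banach, second_countable_topology}"
  assumes "finite_measure M" and "integrable M F"
    and "integrable M (\<lambda>\<omega>. bregman \<Phi> (F \<omega>) g)"
  shows "integrable M (\<lambda>\<omega>. real_of_ereal (\<Phi> (F \<omega>)))"
proof -
  interpret finite_measure M by fact
  have "integrable M (\<lambda>\<omega>. bregman \<Phi> (F \<omega>) g + real_of_ereal (\<Phi> g)
      + inner (frechet_gradient \<Phi> g) (F \<omega> - g))"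
    using assms by simp
  then show ?thesis
    by (simp add: bregman_def)
qed

context prob_space
begin

text \<open>Total mass 1 lets constants integrate to themselves. The point \<open>h\<close> stays
  free: one formula serves both \<open>g\<close> and the mean.\<close>

lemma has_bochner_integral_bregman:
  fixes F :: "'a \<Rightarrow> 'b::{real_inner, banach, second_countable_topology}"
  assumes "integrable M F" and "integrable M (\<lambda>\<omega>. real_of_ereal (\<Phi> (F \<omega>)))"
  shows "has_bochner_integral M (\<lambda>\<omega>. bregman \<Phi> (F \<omega>) h)
    (expectation (\<lambda>\<omega>. real_of_ereal (\<Phi> (F \<omega>))) - real_of_ereal (\<Phi> h)
      - inner (frechet_gradient \<Phi> h) (integral\<^sup>L M F - h))"
  unfolding has_bochner_integral_iff bregman_def using assms by (simp add: prob_space)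

end

theorem lemma9:
  fixes \<Phi> :: "'a::{real_inner, banach, second_countable_topology} \<Rightarrow> ereal"
    and U :: "'a set"
    and M :: "'w measure"
    and F :: "'w \<Rightarrow> 'a"
    and g :: 'a
  assumes "generator \<Phi>"
    and "U \<subseteq> interior (edom \<Phi>)" and "U \<noteq> {}" and "convex U"
    and "prob_space M" and "F \<in> borel_measurable M"
    and "measure M {\<omega> \<in> space M. F \<omega> \<in> U} = 1"
    and "integrable M (\<lambda>\<omega>. norm (F \<omega>))"
    and "(\<integral>\<^sup>+ \<omega>. e2ennreal \<bar>\<Phi> (F \<omega>)\<bar> \<partial>M) < \<infinity>"
    and "integral\<^sup>L M F \<in> U"
    and "g \<in> U"
    and "integrable M (\<lambda>\<omega>. bregman \<Phi> (F \<omega>) g)"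
  shows "integrable M (\<lambda>\<omega>. bregman \<Phi> (F \<omega>) (integral\<^sup>L M F))
    \<and> (\<integral>\<omega>. bregman \<Phi> (F \<omega>) g \<partial>M)
        = (\<integral>\<omega>. bregman \<Phi> (F \<omega>) (integral\<^sup>L M F) \<partial>M) + bregman \<Phi> (integral\<^sup>L M F) g"
proof -
  interpret prob_space M by fact
  have F: "integrable M F"
    using assms(6,8) by (simp add: integrable_norm_iff)
  note bregman_integral = has_bochner_integral_bregman
    [OF F integrable_Phi_if_integrable_bregman[OF finite_measure_axioms F assms(12)]]
  \<comment> \<open>Unfolding \<open>bregman\<close> only at the mean and \<open>g\<close> keeps the
    integrands folded, so both integral values rewrite; the \<open>\<Phi>\<close> terms at the mean
    then cancel.\<close>
  show ?thesis
    using bregman_integral[of g] bregman_integral[of "integral\<^sup>L M F"]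
    by (simp add: has_bochner_integral_iff bregman_def[of \<Phi> "integral\<^sup>L M F" g])
qed

end
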